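(* Let $Y$ be a discrete topological space. The following conditions are equivalent: (a) $|Y|\leq\mathfrak c$; (b) $\omega^{*}\rightarrow(Y)^{1}_{\mathfrak c}$; (c) $\omega^{*}\rightarrow(Y)^{1}_{2}$; (d) $Y$ is homeomorphic to a subspace of $\omega^{*}$.
   Context: $\mathfrak c=2^{\aleph_0}$. $\omega$ is the countably infinite discrete space, $\beta(\omega)$ its Stone-Čech compactification, and $\omega^{*}=\beta(\omega)\setminus\omega$ with the subspace topology. For topological spaces $X,Y$ and a cardinal $\lambda$, the relation $X\rightarrow(Y)^{1}_{\lambda}$ means: whenever $X=\bigcup_{i<\lambda}P_i$, there are $i<\lambda$ and $Y'\subseteq P_i$ such that $Y'$ (with the subspace topology from $X$) is homeomorphic to $Y$. *)

theory Defs
  imports "HOL-Analysis.Analysis"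
begin

unbundle cardinal_syntax

text \<open>The Stone-Cech compactification of a (completely regular Hausdorff) space \<open>X\<close>: the closure
  of the image of \<open>X\<close> in the cube \<open>[0,1]\<^bsup>C(X,[0,1])\<^esup>\<close> under the evaluation map. Members of
  \<open>C(X,[0,1])\<close> are taken extensional, so that distinct coordinates are distinct maps on \<open>X\<close>.\<close>

definition unit_maps :: "'a topology \<Rightarrow> ('a \<Rightarrow> real) set"
  where "unit_maps X =
    {f \<in> extensional (topspace X). continuous_map X (top_of_set {0..1}) f}"

definition unit_cube :: "'a topology \<Rightarrow> (('a \<Rightarrow> real) \<Rightarrow> real) topology"
  where "unit_cube X = product_topology (\<lambda>f. top_of_set {0..1}) (unit_maps X)"

definition stone_cech_map :: "'a topology \<Rightarrow> 'a \<Rightarrow> ('a \<Rightarrow> real) \<Rightarrow> real"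
  where "stone_cech_map X x = (\<lambda>f\<in>unit_maps X. f x)"

definition stone_cech :: "'a topology \<Rightarrow> (('a \<Rightarrow> real) \<Rightarrow> real) topology"
  where "stone_cech X =
    subtopology (unit_cube X) (unit_cube X closure_of (stone_cech_map X ` topspace X))"

text \<open>The defining properties: a compact Hausdorff space containing \<open>X\<close> as a dense subspace, to
  which every continuous map from \<open>X\<close> to the unit interval extends.\<close>

lemma compact_space_stone_cech: "compact_space (stone_cech X)"
proof -
  have "compact_space (unit_cube X)"
    by (simp add: unit_cube_def compact_space_product_topology compact_space_subtopology)
  then show ?thesis
    by (simp add: stone_cech_def closedin_compact_space compact_space_subtopology)
qed

lemma Hausdorff_space_stone_cech: "Hausdorff_space (stone_cech X)"
  by (simp add: stone_cech_def unit_cube_def Hausdorff_space_subtopology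
      Hausdorff_space_product_topology)

lemma stone_cech_map_image: "stone_cech_map X ` topspace X \<subseteq> topspace (unit_cube X)"
proof -
  have "f x \<in> {0..1}" if "x \<in> topspace X" "f \<in> unit_maps X" for f x
    using that unfolding unit_maps_def continuous_map_in_subtopology by blast
  then show ?thesis
    unfolding unit_cube_def topspace_product_topology stone_cech_map_def by auto
qed

lemma embedding_map_stone_cech:
  assumes "completely_regular_space X" "Hausdorff_space X"
  shows "embedding_map X (stone_cech X) (stone_cech_map X)"
proof -
  have "bounded (f ` topspace X)" if "f \<in> topspace X \<rightarrow> {0..1::real}" for f
    by (rule bounded_subset[of "{0..1::real}"]) (use that in auto)
  then have K: "mspace (submetric (cfunspace X euclidean_metric)
      {f. f \<in> topspace X \<rightarrow> {0..1}}) = unit_maps X"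
    by (auto simp: unit_maps_def continuous_map_in_subtopology)
  have "embedding_map X (unit_cube X) (stone_cech_map X)"
    using completely_regular_space_cube_embedding_explicit[OF assms]
    unfolding K unit_cube_def stone_cech_map_def by simp
  then show ?thesis
    unfolding stone_cech_def embedding_map_in_subtopology
    by (intro conjI closure_of_subset stone_cech_map_image)
qed

lemma stone_cech_dense:
  "stone_cech X closure_of (stone_cech_map X ` topspace X) = topspace (stone_cech X)"
proof -
  let ?E = "stone_cech_map X ` topspace X"
  have "?E \<subseteq> unit_cube X closure_of ?E"
    by (intro closure_of_subset stone_cech_map_image)
  then show ?thesis
    unfolding stone_cech_def closure_of_subtopology topspace_subtopology
    using closure_of_subset_topspace[of "unit_cube X" ?E] by (simp add: Int_absorb1 Int_absorb2)
qed

lemma stone_cech_extension: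
  assumes "continuous_map X (top_of_set {0..1::real}) f"
  obtains g where "continuous_map (stone_cech X) (top_of_set {0..1}) g"
    "\<And>x. x \<in> topspace X \<Longrightarrow> g (stone_cech_map X x) = f x"
proof
  let ?f = "restrict f (topspace X)"
  have f: "?f \<in> unit_maps X"
    using assms by (auto simp: unit_maps_def intro: continuous_map_eq)
  show "continuous_map (stone_cech X) (top_of_set {0..1}) (\<lambda>p. p ?f)"
    unfolding stone_cech_def unit_cube_def
    by (intro continuous_map_from_subtopology continuous_map_product_projection f)
  show "stone_cech_map X x ?f = f x" if "x \<in> topspace X" for x
    using f that by (simp add: stone_cech_map_def)
qed

definition omega :: "nat topology"
  where "omega = discrete_topology UNIV"

definition omega_star :: "((nat \<Rightarrow> real) \<Rightarrow> real) topology"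
  where "omega_star =
    subtopology (stone_cech omega)
      (topspace (stone_cech omega) - stone_cech_map omega ` topspace omega)"

text \<open>The cardinal \<open>\<kappa>\<close> is a cardinal order in the sense of the library; its elements, the
  indices \<open>i < \<kappa>\<close>, form \<open>Field \<kappa>\<close>.\<close>

definition partition_arrow :: "'a topology \<Rightarrow> 'b topology \<Rightarrow> 'i rel \<Rightarrow> bool"
  where "partition_arrow X Y \<kappa> \<longleftrightarrow>
    (\<forall>P. topspace X = (\<Union>i\<in>Field \<kappa>. P i) \<longrightarrow>
      (\<exists>i\<in>Field \<kappa>. \<exists>Y'\<subseteq>P i. subtopology X Y' homeomorphic_space Y))"

definition continuum :: "(nat \<Rightarrow> bool) rel"
  where "continuum = ctwo ^c natLeq"

end

theory Submission
  imports Defs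
begin

text \<open>Write \<open>A*\<close> for the trace on \<open>\<omega>*\<close> of the closure of \<open>A \<subseteq> \<omega>\<close> in \<open>\<beta>(\<omega>)\<close>. Kunen's matrix
  consists of sets \<open>A i j\<close>, indexed by \<open>i, j < \<cc>\<close>, such that any two sets in one row are almost
  disjoint while any finitely many sets from distinct rows have infinite intersection. If
  \<open>\<omega>*\<close> is the union of the \<open>P i\<close>, then some \<open>P i\<close> meets \<open>A i j*\<close> for every \<open>j\<close>: otherwise choose
  \<open>h i\<close> with \<open>A i (h i)*\<close> disjoint from \<open>P i\<close>, and by compactness a point common to all
  \<open>A i (h i)*\<close>, which lies in no \<open>P i\<close>. Choosing a point of \<open>P i\<close> in each of the disjoint open
  sets \<open>A i j*\<close> yields a discrete subspace of \<open>P i\<close> of size \<open>\<cc>\<close>.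

  Conversely, in a regular space with a countable dense set, a point of a discrete subspace is
  determined by the trace of a small neighbourhood on the dense set, so that discrete subspaces
  have size at most \<open>\<cc>\<close>.\<close>

section \<open>Discrete spaces, and the size of discrete subspaces of regular spaces\<close>

lemma continuum_eq: "continuum = |UNIV :: (nat \<Rightarrow> bool) set|"
  by (simp add: continuum_def cexp_def ctwo_def Field_card_of Field_natLeq Func_def)

lemma discrete_topology_homeomorphic_space:
  assumes "inj_on h D"
  shows "discrete_topology D homeomorphic_space discrete_topology (h ` D)"
proof -
  have "homeomorphic_map (discrete_topology D) (discrete_topology (h ` D)) h"
    using assms by (intro bijective_open_imp_homeomorphic_map) (auto simp: open_map_def)
  then show ?thesis
    by (rule homeomorphic_map_imp_homeomorphic_space)
qed

lemma homeomorphic_space_discrete_topology: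
  assumes "discrete_topology D homeomorphic_space X"
  obtains h where "inj_on h D" "X = discrete_topology (h ` D)"
proof -
  obtain h where h: "homeomorphic_map (discrete_topology D) X h"
    using assms homeomorphic_space by blast
  have "discrete_topology (h ` D) = X"
    unfolding discrete_topology_unique
    using homeomorphic_map_openness_eq[OF h] homeomorphic_imp_surjective_map[OF h]
    by (fastforce simp: homeomorphic_map_openness[OF h, symmetric])
  then show ?thesis
    using that homeomorphic_imp_injective_map[OF h] by simp
qed

text \<open>Regularity gives each \<open>y\<close> of \<open>S\<close> an open neighbourhood
  \<open>U y\<close> inside a closed set \<open>C y\<close> that meets \<open>S\<close> only in
  \<open>y\<close>. The closure of the trace of \<open>U y\<close> on the dense set contains
  \<open>y\<close> and stays within \<open>C y\<close>, so the trace determines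
  \<open>y\<close>.\<close>

lemma card_of_discrete_subspace:
  assumes reg: "regular_space X" and dense: "X closure_of (e ` I) = topspace X"
    and S: "S \<subseteq> topspace X" and discr: "subtopology X S = discrete_topology S"
  shows "|S| \<le>o |Pow I|"
proof -
  have "\<exists>U C. openin X U \<and> closedin X C \<and> y \<in> U \<and> U \<subseteq> C \<and> C \<inter> S \<subseteq> {y}" if "y \<in> S" for y
  proof -
    have "openin (subtopology X S) {y}"
      using that discr by simp
    then obtain W where W: "openin X W" "{y} = W \<inter> S"
      unfolding openin_subtopology by blast
    moreover have "y \<in> topspace X - (topspace X - W)"
      using W that S by blast
    ultimately obtain U V where "openin X U" "openin X V" "y \<in> U" "topspace X - W \<subseteq> V"
      "disjnt U V"
      using reg unfolding regular_space_def by (metis closedin_diff closedin_topspace)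
    then show ?thesis
      using W S openin_subset[of X U]
      by (intro exI[of _ U] exI[of _ "topspace X - V"]) (auto simp: disjnt_iff)
  qed
  then obtain U C where U: "\<And>y. y \<in> S \<Longrightarrow> openin X (U y)" "\<And>y. y \<in> S \<Longrightarrow> y \<in> U y"
    and C: "\<And>y. y \<in> S \<Longrightarrow> closedin X (C y)" "\<And>y. y \<in> S \<Longrightarrow> U y \<subseteq> C y"
      "\<And>y. y \<in> S \<Longrightarrow> C y \<inter> S \<subseteq> {y}"
    by metis
  define t where "t y = {i \<in> I. e i \<in> U y}" for y
  have "y \<in> X closure_of (e ` t y)" if "y \<in> S" for y
  proof -
    have "y \<in> U y \<inter> X closure_of (e ` I)"
      using that U S dense by auto
    then have "y \<in> X closure_of (U y \<inter> e ` I)"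
      using openin_Int_closure_of_subset[OF U(1)[OF that], of "e ` I"] by blast
    also have "U y \<inter> e ` I = e ` t y"
      by (auto simp: t_def)
    finally show ?thesis .
  qed
  moreover have "X closure_of (e ` t y) \<subseteq> C y" if "y \<in> S" for y
    using C(1,2)[OF that] by (intro closure_of_minimal) (auto simp: t_def)
  ultimately have "inj_on t S"
    using C(3) by (intro inj_onI) (metis IntI singletonD subsetD)
  moreover have "t ` S \<subseteq> Pow I"
    by (auto simp: t_def)
  ultimately show ?thesis
    using card_of_ordLeq by blast
qed

section \<open>Closures of sets of integers in the compactification\<close>

definition beta_closure :: "nat set \<Rightarrow> ((nat \<Rightarrow> real) \<Rightarrow> real) set"
  where "beta_closure A = stone_cech omega closure_of (stone_cech_map omega ` A)"

lemma stone_cech_map_omega_in_topspace: "stone_cech_map omega n \<in> topspace (stone_cech omega)"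
  using stone_cech_map_image[of omega] closure_of_subset
  unfolding stone_cech_def omega_def by fastforce

lemma beta_closure_UNIV: "beta_closure UNIV = topspace (stone_cech omega)"
  using stone_cech_dense[of omega] by (simp add: beta_closure_def omega_def)

lemma beta_closure_Un: "beta_closure (A \<union> B) = beta_closure A \<union> beta_closure B"
  by (simp add: beta_closure_def image_Un)

lemma closedin_beta_closure: "closedin (stone_cech omega) (beta_closure A)"
  by (simp add: beta_closure_def)

lemma stone_cech_map_in_beta_closure: "n \<in> A \<Longrightarrow> stone_cech_map omega n \<in> beta_closure A"
  unfolding beta_closure_def
  by (rule subsetD[OF closure_of_subset]) (auto simp: stone_cech_map_omega_in_topspace)

lemma beta_closure_finite:
  assumes "finite A"
  shows "beta_closure A = stone_cech_map omega ` A"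
proof -
  have "closedin (stone_cech omega) (stone_cech_map omega ` A)"
    using assms stone_cech_map_omega_in_topspace
    by (intro closedin_Hausdorff_finite Hausdorff_space_stone_cech) auto
  then show ?thesis
    by (simp add: beta_closure_def closure_of_closedin)
qed

text \<open>Every function on a discrete space is continuous, so the indicator of \<open>A\<close>
  extends to the compactification. The extension is 1 on the closure of \<open>A\<close> and 0 on
  that of \<open>B\<close>.\<close>

lemma beta_closure_disjoint:
  assumes "A \<inter> B = {}"
  shows "beta_closure A \<inter> beta_closure B = {}"
proof -
  have "continuous_map omega (top_of_set {0..1}) (indicat_real A)"
    by (auto simp: omega_def indicator_def)
  then obtain g where g: "continuous_map (stone_cech omega) (top_of_set {0..1}) g"
    "\<And>n. g (stone_cech_map omega n) = indicat_real A n"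
    by (rule stone_cech_extension) (simp add: omega_def)
  have closure: "beta_closure D \<subseteq> {p \<in> topspace (stone_cech omega). g p \<in> {c}}"
    if "\<And>n. n \<in> D \<Longrightarrow> indicat_real A n = c" for D c
  proof -
    have "continuous_map (stone_cech omega) euclidean g"
      using g(1) continuous_map_in_subtopology by blast
    then have "closedin (stone_cech omega) {p \<in> topspace (stone_cech omega). g p \<in> {c}}"
      by (rule closedin_continuous_map_preimage) simp
    then show ?thesis
      unfolding beta_closure_def using that g(2) stone_cech_map_omega_in_topspace
      by (intro closure_of_minimal) auto
  qed
  have "beta_closure A \<subseteq> {p \<in> topspace (stone_cech omega). g p \<in> {1}}"
    by (rule closure) simp
  moreover have "beta_closure B \<subseteq> {p \<in> topspace (stone_cech omega). g p \<in> {0}}"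
    using assms by (intro closure) (auto simp: indicator_def)
  ultimately show ?thesis
    by force
qed

lemma openin_beta_closure: "openin (stone_cech omega) (beta_closure A)"
proof -
  have "beta_closure A \<union> beta_closure (- A) = topspace (stone_cech omega)"
    by (simp flip: beta_closure_Un add: beta_closure_UNIV)
  moreover have "beta_closure A \<inter> beta_closure (- A) = {}"
    by (simp add: beta_closure_disjoint)
  ultimately have "beta_closure A = topspace (stone_cech omega) - beta_closure (- A)"
    by blast
  then show ?thesis
    using closedin_beta_closure by (metis openin_diff openin_topspace)
qed

lemma topspace_omega_star:
  "topspace omega_star = topspace (stone_cech omega) - range (stone_cech_map omega)"
  by (auto simp: omega_star_def omega_def)

text \<open>The finite set \<open>A \<inter> B\<close> is closed in the compactification, so its
  closure adds no point of \<open>omega_star\<close>; the closure of the rest of \<open>A\<close>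
  misses that of \<open>B\<close>.\<close>

lemma beta_closure_almost_disjoint:
  assumes "finite (A \<inter> B)"
  shows "beta_closure A \<inter> beta_closure B \<inter> topspace omega_star = {}"
proof -
  have "beta_closure A = beta_closure (A \<inter> B) \<union> beta_closure (A - B)"
    by (simp add: Un_Diff_Int Un_commute flip: beta_closure_Un)
  moreover have "beta_closure (A - B) \<inter> beta_closure B = {}"
    by (rule beta_closure_disjoint) blast
  ultimately show ?thesis
    using beta_closure_finite[OF assms] by (auto simp: topspace_omega_star)
qed

text \<open>Compactness is applied to the closures of all \<open>A i\<close> together with those of
  the sets \<open>- {n}\<close>, which keep the common point away from the integers.\<close>

lemma omega_star_point_in_beta_closures:
  assumes inf: "\<And>F. finite F \<Longrightarrow> infinite (\<Inter>i\<in>F. A i)"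
  obtains p where "p \<in> topspace omega_star" "\<And>i. p \<in> beta_closure (A i)"
proof -
  let ?\<U> = "beta_closure ` (range A \<union> range (\<lambda>n. - {n}))"
  have "\<Inter>\<F> \<noteq> {}" if fin: "finite \<F>" and sub: "\<F> \<subseteq> ?\<U>" for \<F>
  proof -
    obtain \<G> where \<G>: "finite \<G>" "\<G> \<subseteq> range A \<union> range (\<lambda>n. - {n})" "\<F> = beta_closure ` \<G>"
      using finite_subset_image[OF fin sub] by blast
    obtain F where F: "finite F" "\<G> \<inter> range A = A ` F"
      using finite_subset_image[of "\<G> \<inter> range A" A UNIV] \<G>(1) by blast
    obtain N where N: "finite N" "\<G> \<inter> range (\<lambda>n. - {n}) = (\<lambda>n. - {n}) ` N"
      using finite_subset_image[of "\<G> \<inter> range (\<lambda>n. - {n})" "\<lambda>n. - {n}" UNIV] \<G>(1) by blast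
    \<comment> \<open>An infinite intersection has a member outside the finite set \<open>N\<close>,
      and the image of this integer witnesses the finite intersection property.\<close>
    obtain m where m: "m \<in> (\<Inter>i\<in>F. A i)" "m \<notin> N"
      using inf[OF F(1)] N(1) by (meson finite_subset subsetI)
    have "m \<in> B" if "B \<in> \<G>" for B
    proof (cases "B \<in> range A")
      case True
      then have "B \<in> \<G> \<inter> range A" using that by simp
      then have "B \<in> A ` F" unfolding F(2) .
      then show ?thesis using m by blast
    next
      case False
      then have "B \<in> \<G> \<inter> range (\<lambda>n. - {n})" using that subsetD[OF \<G>(2)] by auto
      then have "B \<in> (\<lambda>n. - {n}) ` N" unfolding N(2) .
      then show ?thesis using m by blast
    qed
    then have "stone_cech_map omega m \<in> \<Inter>\<F>"
      by (auto simp: \<G>(3) intro: stone_cech_map_in_beta_closure)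
    then show ?thesis by blast
  qed
  then have "\<Inter>?\<U> \<noteq> {}"
    using compact_space_stone_cech[of omega] closedin_beta_closure
    unfolding compact_space_fip by (elim allE[of _ ?\<U>]) auto
  then obtain p where p: "p \<in> \<Inter>?\<U>" by blast
  have "p \<in> topspace (stone_cech omega)"
    using p closedin_subset[OF closedin_beta_closure] by blast
  moreover have "p \<noteq> stone_cech_map omega n" for n
    using p beta_closure_disjoint[of "{n}" "- {n}"] stone_cech_map_in_beta_closure[of n "{n}"]
    by blast
  ultimately have "p \<in> topspace omega_star"
    by (auto simp: topspace_omega_star)
  moreover have "p \<in> beta_closure (A i)" for i
    using p by blast
  ultimately show ?thesis
    using that by blast
qed

section \<open>Kunen's independent matrix\<close>

definition initial_segment :: "nat \<Rightarrow> (nat \<Rightarrow> bool) \<Rightarrow> bool list"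
  where "initial_segment k x = map x [0..<k]"

lemma length_initial_segment: "length (initial_segment k x) = k"
  by (simp add: initial_segment_def)

lemma initial_segment_eq_iff: "initial_segment k x = initial_segment k y \<longleftrightarrow> (\<forall>n<k. x n = y n)"
  by (auto simp: initial_segment_def)

lemma eventually_initial_segment_neq:
  assumes "x \<noteq> y"
  shows "\<forall>\<^sub>F k in sequentially. initial_segment k x \<noteq> initial_segment k y"
proof -
  obtain n where "x n \<noteq> y n"
    using assms by blast
  then show ?thesis
    unfolding eventually_sequentially initial_segment_eq_iff by (meson Suc_le_lessD)
qed

definition segment_maps :: "nat \<Rightarrow> (bool list \<Rightarrow> bool list) set"
  where "segment_maps k = {xs. length xs = k} \<rightarrow>\<^sub>E {xs. length xs = k}"

text \<open>A countable set in place of \<omega>, on which the matrix is built before it is coded by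
  integers.\<close>

definition kunen_index :: "(nat \<times> (bool list \<Rightarrow> bool list)) set"
  where "kunen_index = Sigma UNIV segment_maps"

text \<open>Here \<open>x\<close> is the row and \<open>y\<close> the column.\<close>

definition kunen_cell ::
  "(nat \<Rightarrow> bool) \<Rightarrow> (nat \<Rightarrow> bool) \<Rightarrow> (nat \<times> (bool list \<Rightarrow> bool list)) set"
  where "kunen_cell x y =
    {(k, f) \<in> kunen_index. f (initial_segment k x) = initial_segment k y}"

lemma finite_segment_maps: "finite (segment_maps k)"
  unfolding segment_maps_def
  using finite_lists_length_eq[of "UNIV :: bool set" k] by (intro finite_PiE) auto

lemma countable_kunen_index: "countable kunen_index"
  unfolding kunen_index_def by (simp add: countable_finite finite_segment_maps)

text \<open>Once \<open>k\<close> exceeds a place where \<open>y\<close> and \<open>z\<close>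
  differ, \<open>f\<close> would need two values at one segment. The finitely many smaller
  \<open>k\<close> admit finitely many \<open>f\<close> each.\<close>

lemma finite_kunen_cell_Int:
  assumes "y \<noteq> z"
  shows "finite (kunen_cell x y \<inter> kunen_cell x z)"
proof -
  obtain m where m: "\<And>k. k \<ge> m \<Longrightarrow> initial_segment k y \<noteq> initial_segment k z"
    using eventually_initial_segment_neq[OF assms] unfolding eventually_sequentially by blast
  have "kunen_cell x y \<inter> kunen_cell x z \<subseteq> Sigma {..<m} segment_maps"
    using m by (force simp: kunen_cell_def kunen_index_def not_le[symmetric])
  then show ?thesis
    by (rule finite_subset) (simp add: finite_segment_maps)
qed

text \<open>For large \<open>k\<close> the rows in \<open>F\<close> have distinct segments of length
  \<open>k\<close>, so a single map can take a prescribed value at each of them. Every such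
  \<open>k\<close> contributes an element.\<close>

lemma infinite_kunen_cell_INT:
  assumes "finite F"
  shows "infinite (kunen_index \<inter> (\<Inter>x\<in>F. kunen_cell x (h x)))"
proof -
  have "\<forall>\<^sub>F k in sequentially. \<forall>x\<in>F. \<forall>y\<in>F. x \<noteq> y \<longrightarrow> initial_segment k x \<noteq> initial_segment k y"
    using assms
    by (simp add: eventually_ball_finite_distrib eventually_initial_segment_neq)
  then obtain m where
    m: "\<And>k. k \<ge> m \<Longrightarrow> inj_on (initial_segment k) F"
    unfolding eventually_sequentially inj_on_def by blast
  have "k \<in> fst ` (kunen_index \<inter> (\<Inter>x\<in>F. kunen_cell x (h x)))" if "k \<ge> m" for k
  proof -
    \<comment> \<open>At a segment of no row in \<open>F\<close>, \<open>inv_into\<close> returns an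
      unspecified sequence; the value is still a list of length \<open>k\<close>, as
      \<open>segment_maps\<close> demands.\<close>
    define f where "f = (\<lambda>s\<in>{s. length s = k}.
      initial_segment k (h (inv_into F (initial_segment k) s)))"
    have "f \<in> segment_maps k"
      by (auto simp: f_def segment_maps_def length_initial_segment)
    moreover have "f (initial_segment k x) = initial_segment k (h x)" if "x \<in> F" for x
      using that m[OF \<open>k \<ge> m\<close>] by (simp add: f_def length_initial_segment)
    ultimately have "(k, f) \<in> kunen_index \<inter> (\<Inter>x\<in>F. kunen_cell x (h x))"
      by (auto simp: kunen_index_def kunen_cell_def)
    then show ?thesis
      by force
  qed
  then have "{m..} \<subseteq> fst ` (kunen_index \<inter> (\<Inter>x\<in>F. kunen_cell x (h x)))"
    by blast
  then show ?thesis
    using infinite_Ici[of m] finite_subset by blast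
qed

lemma kunen_matrix:
  obtains A :: "(nat \<Rightarrow> bool) \<Rightarrow> (nat \<Rightarrow> bool) \<Rightarrow> nat set"
  where "\<And>x y z. y \<noteq> z \<Longrightarrow> finite (A x y \<inter> A x z)"
    "\<And>F h. finite F \<Longrightarrow> infinite (\<Inter>x\<in>F. A x (h x))"
proof -
  let ?code = "to_nat_on kunen_index"
  have inj: "inj_on ?code kunen_index"
    by (rule inj_on_to_nat_on[OF countable_kunen_index])
  have sub: "kunen_cell x y \<subseteq> kunen_index" for x y
    by (auto simp: kunen_cell_def)
  show ?thesis
  proof
    fix x y z :: "nat \<Rightarrow> bool"
    assume "y \<noteq> z"
    then show "finite (?code ` kunen_cell x y \<inter> ?code ` kunen_cell x z)"
      by (simp add: finite_kunen_cell_Int flip: inj_on_image_Int[OF inj sub sub])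
  next
    fix F :: "(nat \<Rightarrow> bool) set" and h
    assume "finite F"
    \<comment> \<open>The factor \<open>kunen_index\<close> keeps the set within the domain of
      injectivity of the coding even when \<open>F\<close> is empty.\<close>
    let ?I = "kunen_index \<inter> (\<Inter>x\<in>F. kunen_cell x (h x))"
    have "infinite (?code ` ?I)"
      using infinite_kunen_cell_INT[OF \<open>finite F\<close>] inj
      by (metis Int_lower1 finite_imageD inj_on_subset)
    moreover have "?code ` ?I \<subseteq> (\<Inter>x\<in>F. ?code ` kunen_cell x (h x))"
      by blast
    ultimately show "infinite (\<Inter>x\<in>F. ?code ` kunen_cell x (h x))"
      using finite_subset by blast
  qed
qed

section \<open>The partition relation\<close>

lemma omega_star_partition_discrete:
  fixes P :: "(nat \<Rightarrow> bool) \<Rightarrow> ((nat \<Rightarrow> real) \<Rightarrow> real) set"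
  assumes P: "topspace omega_star = (\<Union>x. P x)"
  obtains x and q :: "(nat \<Rightarrow> bool) \<Rightarrow> (nat \<Rightarrow> real) \<Rightarrow> real"
  where "inj q" "range q \<subseteq> P x"
    "subtopology omega_star (range q) = discrete_topology (range q)"
proof -
  obtain A :: "(nat \<Rightarrow> bool) \<Rightarrow> (nat \<Rightarrow> bool) \<Rightarrow> nat set"
    where disj: "\<And>x y z. y \<noteq> z \<Longrightarrow> finite (A x y \<inter> A x z)"
      and indep: "\<And>F h. finite F \<Longrightarrow> infinite (\<Inter>x\<in>F. A x (h x))"
    using kunen_matrix by metis
  have "\<exists>x. \<forall>y. P x \<inter> beta_closure (A x y) \<noteq> {}"
  proof (rule ccontr)
    assume "\<not> ?thesis"
    then obtain h where h: "\<And>x. P x \<inter> beta_closure (A x (h x)) = {}"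
      by metis
    obtain p where "p \<in> topspace omega_star" "\<And>x. p \<in> beta_closure (A x (h x))"
      using omega_star_point_in_beta_closures[of "\<lambda>x. A x (h x)"] indep by blast
    then show False
      using h P by blast
  qed
  then obtain x where "\<forall>y. \<exists>p. p \<in> P x \<and> p \<in> beta_closure (A x y)"
    by blast
  then obtain q where q: "\<And>y. q y \<in> P x" "\<And>y. q y \<in> beta_closure (A x y)"
    by metis
  have star: "q y \<in> topspace omega_star" for y
    using q P by blast
  \<comment> \<open>The closure of column \<open>z\<close> in row \<open>x\<close> contains no
    chosen point but \<open>q z\<close>. This gives both the injectivity of \<open>q\<close> and the
    isolation of its values.\<close>
  have eq: "y = z" if "q y \<in> beta_closure (A x z)" for y z
    using that q(2)[of y] star[of y] beta_closure_almost_disjoint[OF disj[of y z x]] by blast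
  have "inj q"
    using eq q(2) by (metis injI)
  moreover have "discrete_topology (range q) = subtopology omega_star (range q)"
    unfolding discrete_topology_unique
  proof safe
    fix y
    have "openin omega_star (topspace omega_star \<inter> beta_closure (A x y))"
      unfolding omega_star_def topspace_subtopology_subset[OF Diff_subset]
      by (rule openin_subtopology_Int2[OF openin_beta_closure])
    moreover have "{q y} = topspace omega_star \<inter> beta_closure (A x y) \<inter> range q"
      using q eq star by blast
    ultimately show "openin (subtopology omega_star (range q)) {q y}"
      unfolding openin_subtopology by blast
  qed (use star in auto)
  ultimately show ?thesis
    using that q(1) by (metis image_subset_iff)
qed

lemma partition_arrow_continuum:
  assumes "|D| \<le>o continuum"
  shows "partition_arrow omega_star (discrete_topology D) continuum"
  unfolding partition_arrow_def
proof (intro allI impI)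
  fix P
  assume "topspace omega_star = (\<Union>x\<in>Field continuum. P x)"
  then have P: "topspace omega_star = (\<Union>x. P x)"
    by (simp add: continuum_eq Field_card_of)
  obtain x and q :: "(nat \<Rightarrow> bool) \<Rightarrow> (nat \<Rightarrow> real) \<Rightarrow> real"
    where q: "inj q" "range q \<subseteq> P x"
    "subtopology omega_star (range q) = discrete_topology (range q)"
    using omega_star_partition_discrete[OF P] .
  obtain g :: "'a \<Rightarrow> nat \<Rightarrow> bool" where g: "inj_on g D"
    using assms card_of_ordLeq[of D "UNIV :: (nat \<Rightarrow> bool) set"] by (auto simp: continuum_eq)
  \<comment> \<open>\<open>g\<close> picks as many columns as \<open>D\<close> has points; the
    corresponding values of \<open>q\<close> form a subset of a discrete subspace, hence a discrete
    subspace.\<close>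
  let ?Y = "(q \<circ> g) ` D"
  have "subtopology omega_star ?Y = subtopology (subtopology omega_star (range q)) ?Y"
    unfolding subtopology_subtopology by (rule arg_cong[where f = "subtopology omega_star"]) auto
  also have "\<dots> = discrete_topology ?Y"
    unfolding q(3) subtopology_discrete_topology by (rule arg_cong[where f = discrete_topology]) auto
  finally have discr: "subtopology omega_star ?Y = discrete_topology ?Y" .
  have "inj_on (q \<circ> g) D"
    using g q(1) by (intro comp_inj_on) (auto intro: inj_on_subset)
  then have "subtopology omega_star ?Y homeomorphic_space discrete_topology D"
    unfolding discr by (metis discrete_topology_homeomorphic_space homeomorphic_space_sym)
  moreover have "?Y \<subseteq> P x"
    using q(2) by auto
  ultimately show
    "\<exists>x\<in>Field continuum. \<exists>Y'\<subseteq>P x. subtopology omega_star Y' homeomorphic_space discrete_topology D"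
    by (auto simp: continuum_eq Field_card_of)
qed

text \<open>The bound is taken in the whole compactification, which is regular and contains the
  image of \<omega> as a countable dense set; that image lies outside
  \<open>omega_star\<close>.\<close>

lemma card_of_discrete_subspace_omega_star:
  assumes S: "S \<subseteq> topspace omega_star" and
    hom: "discrete_topology D homeomorphic_space subtopology omega_star S"
  shows "|D| \<le>o continuum"
proof -
  obtain h where h: "inj_on h D" "subtopology omega_star S = discrete_topology (h ` D)"
    using homeomorphic_space_discrete_topology[OF hom] .
  have "h ` D = S"
    using arg_cong[OF h(2), of topspace] S by auto
  moreover have "subtopology omega_star S = subtopology (stone_cech omega) S"
    using S unfolding omega_star_def subtopology_subtopology
    by (simp add: Int_absorb1)
  moreover have "S \<subseteq> topspace (stone_cech omega)"
    using S topspace_omega_star by blast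
  ultimately have "|S| \<le>o |Pow (UNIV :: nat set)|"
    using h(2) card_of_discrete_subspace[of "stone_cech omega" "stone_cech_map omega" UNIV S]
      stone_cech_dense[of omega] compact_Hausdorff_imp_regular_space
      compact_space_stone_cech[of omega] Hausdorff_space_stone_cech[of omega]
    by (auto simp: omega_def)
  also have "|Pow (UNIV :: nat set)| \<le>o continuum"
    unfolding continuum_eq
    by (rule card_of_ordLeqI[of "\<lambda>A n. n \<in> A"]) (auto simp: inj_on_def fun_eq_iff)
  finally have "|S| \<le>o continuum" .
  moreover have "|D| \<le>o |S|"
    using h(1) \<open>h ` D = S\<close> by (intro card_of_ordLeqI[of h]) auto
  ultimately show ?thesis
    using ordLeq_transitive[of "|D|" "|S|" continuum] by simp
qed

text \<open>A cover indexed by \<open>Field \<mu>\<close> is reindexed, with repetitions, along a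
  surjection from \<open>Field \<kappa>\<close>.\<close>

lemma partition_arrow_mono:
  assumes arrow: "partition_arrow X Y \<kappa>" and le: "|Field \<mu>| \<le>o |Field \<kappa>|" and ne: "Field \<mu> \<noteq> {}"
  shows "partition_arrow X Y \<mu>"
  unfolding partition_arrow_def
proof (intro allI impI)
  fix P
  assume P: "topspace X = (\<Union>i\<in>Field \<mu>. P i)"
  obtain g where g: "g ` Field \<kappa> = Field \<mu>"
    using card_of_ordLeq2[OF ne] le by metis
  then have "topspace X = (\<Union>i\<in>Field \<kappa>. P (g i))"
    using P by (metis image_image)
  then obtain i Y' where "i \<in> Field \<kappa>" "Y' \<subseteq> P (g i)" "subtopology X Y' homeomorphic_space Y"
    using arrow unfolding partition_arrow_def by (metis (no_types, lifting))
  then show "\<exists>i\<in>Field \<mu>. \<exists>Y'\<subseteq>P i. subtopology X Y' homeomorphic_space Y"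
    using g by blast
qed

text \<open>The relation is applied to the cover whose parts all equal the whole space.\<close>

lemma partition_arrow_imp_subspace:
  assumes arrow: "partition_arrow X Y \<kappa>" and ne: "Field \<kappa> \<noteq> {}"
  shows "\<exists>S\<subseteq>topspace X. Y homeomorphic_space subtopology X S"
proof -
  have "topspace X = (\<Union>i\<in>Field \<kappa>. topspace X)"
    using ne by simp
  then show ?thesis
    using arrow unfolding partition_arrow_def by (metis homeomorphic_space_sym)
qed

theorem theorem3p1:
  fixes Y :: "'a topology"
  assumes discrete: "Y = discrete_topology (topspace Y)"
  shows "( |topspace Y| \<le>o continuum \<longleftrightarrow> partition_arrow omega_star Y continuum) \<and>
    (partition_arrow omega_star Y continuum \<longleftrightarrow> partition_arrow omega_star Y ctwo) \<and>
    (partition_arrow omega_star Y ctwo \<longleftrightarrow>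
      (\<exists>S\<subseteq>topspace omega_star. Y homeomorphic_space subtopology omega_star S))"
proof -
  \<comment> \<open>The equivalences follow from the cycle (a), (b), (c), (d), (a) of
    implications.\<close>
  have "partition_arrow omega_star Y continuum" if "|topspace Y| \<le>o continuum"
    using partition_arrow_continuum[OF that] discrete by simp
  moreover have "partition_arrow omega_star Y ctwo" if "partition_arrow omega_star Y continuum"
  proof (rule partition_arrow_mono[OF that])
    show "|Field (ctwo :: bool rel)| \<le>o |Field continuum|"
      unfolding ctwo_def continuum_eq Field_card_of
      by (rule card_of_ordLeqI[of "\<lambda>b n. b"]) (auto simp: inj_on_def fun_eq_iff)
  qed (simp add: ctwo_def Field_card_of)
  moreover have "\<exists>S\<subseteq>topspace omega_star. Y homeomorphic_space subtopology omega_star S"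
    if "partition_arrow omega_star Y ctwo"
    using partition_arrow_imp_subspace[OF that] by (simp add: ctwo_def Field_card_of)
  moreover have "|topspace Y| \<le>o continuum"
    if "\<exists>S\<subseteq>topspace omega_star. Y homeomorphic_space subtopology omega_star S"
    using that card_of_discrete_subspace_omega_star discrete by metis
  ultimately show ?thesis
    by blast
qed

end
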